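(* Let $\mu\in\Delta_m$, $\nu\in\Delta_n$ have positive entries and $C\in\mathbb R^{m\times n}$. There exists a constant $T$ depending only on $\mu,\nu,C$ such that, for every initial pair $(\bar f^0,\bar g^0)\in\partial\mathcal F$, the starting time $t_L$ of the final phase of the cold Sinkhorn dynamics initialized at $(\bar f^0,\bar g^0)$ satisfies $t_L\le T$.
   Context: $\Delta_N$ is the probability simplex in $\mathbb R^N$; $H(p|q)=\sum_I p_I\log(p_I/q_I)$ is relative entropy. **Dual OT polytope.** $\mathcal F=\{(f,g)\in\mathbb R^m\times\mathbb R^n:\ f_i+g_j\le C_{ij}\ \forall i,j\}$; $\partial\mathcal F$ is its Pareto frontier: the set of $(f,g)\in\mathcal F$ such that the only $(f',g')\in\mathcal F$ with $f'_i\ge f_i$ and $g'_j\ge g_j$ for all $i,j$ is $(f,g)$ itself. **The vectors $v^*(\mathcal E),w^*(\mathcal E)$.** For $\mathcal E\subset\{1,\dots,m\}\times\{1,\dots,n\}$, $\Delta_{\mathcal E}$ is the set of probability distributions on $\mathcal E$; for $\pi\in\Delta_{\mathcal E}$, $(X_\sharp\pi)_i=\sum_{j:(i,j)\in\mathcal E}\pi_{ij}$ and $(Y_\sharp\pi)_j=\sum_{i:(i,j)\in\mathcal E}\pi_{ij}$. If the bipartite graph on $\{1,\dots,m\}\sqcup\{1,\dots,n\}$ with edge set $\mathcal E$ has no isolated vertex, let $\mu^*(\mathcal E)$ be the minimizer of $H(\bar\mu|\mu)$ over $\bar\mu$ such that there is $Q\in\Delta_{\mathcal E}$ with $X_\sharp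 Q=\bar\mu$, $Y_\sharp Q=\nu$; let $\nu^*(\mathcal E)$ be the minimizer of $H(\bar\nu|\nu)$ over $\bar\nu$ such that there is $P\in\Delta_{\mathcal E}$ with $X_\sharp P=\mu$, $Y_\sharp P=\bar\nu$; and $v^*(\mathcal E)_i=\log(\mu_i/\mu^*_i(\mathcal E))$, $w^*(\mathcal E)_j=\log(\nu_j/\nu^*_j(\mathcal E))$. **Cold Sinkhorn dynamics.** For $(\bar f^0,\bar g^0)\in\partial\mathcal F$, it is the continuous curve with $f(0)=\bar f^0$, $g(0)=\bar g^0$ and $\frac{d}{dt}f(t)=\bar v^\ell$, $\frac{d}{dt}g(t)=\bar w^\ell$ for $t\in[t_\ell,t_{\ell+1})$, $\ell\le L$, where $(t_\ell,\bar v^\ell,\bar w^\ell,\mathcal E^\ell)_{\ell\le L}$ is defined recursively: $t_0=0$, $\mathcal E^0=\{(i,j):\bar f^0_i+\bar g^0_j-C_{ij}=0\}$, $\bar v^0=v^*(\mathcal E^0)$, $\bar w^0=w^*(\mathcal E^0)$; and for $\ell\ge0$, $$t_{\ell+1}=\inf\Big\{t\ge t_\ell:\ \max_{(i,j)\notin\mathcal E^\ell} f_i(t_\ell)+g_j(t_\ell)+(t-t_\ell)(\bar v^\ell_i+\bar w^\ell_j)-C_{ij}\ge0\Big\}.$$ If $t_{\ell+1}<\infty$, then $\mathcal E^{\ell+1}=\{(i,j): f_i(t_\ell)+g_j(t_\ell)+(t_{\ell+1}-t_\ell)(\bar v^\ell_i+\bar w^\ell_j)-C_{ij}=0\}$,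 $\bar v^{\ell+1}=v^*(\mathcal E^{\ell+1})$, $\bar w^{\ell+1}=w^*(\mathcal E^{\ell+1})$. If $t_{\ell+1}=\infty$, then $L=\ell$ and the sequence stops. Set $t_{L+1}=\infty$. (All the sets $\mathcal E^\ell$ arising have no isolated vertex, and $L$ is finite.) *)

theory Defs
  imports "HOL-Analysis.Analysis"
begin

definition prob_simplex :: "(real ^ 'k) set" where
  "prob_simplex = {p. (\<forall>i. 0 \<le> p $ i) \<and> (\<Sum>i\<in>UNIV. p $ i) = 1}"

text \<open>Only used with a strictly positive second argument; the convention \<open>0 log 0 = 0\<close> is
  built in.\<close>

definition rel_entropy :: "real ^ 'k \<Rightarrow> real ^ 'k \<Rightarrow> real" where
  "rel_entropy p q = (\<Sum>i\<in>UNIV. p $ i * ln (p $ i / q $ i))"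

definition dual_polytope :: "real ^ 'n ^ 'm \<Rightarrow> ((real ^ 'm) \<times> (real ^ 'n)) set" where
  "dual_polytope C = {(f, g). \<forall>i j. f $ i + g $ j \<le> C $ i $ j}"

definition pareto_frontier :: "real ^ 'n ^ 'm \<Rightarrow> ((real ^ 'm) \<times> (real ^ 'n)) set" where
  "pareto_frontier C = {(f, g) \<in> dual_polytope C.
     \<forall>(f', g') \<in> dual_polytope C.
       (\<forall>i. f $ i \<le> f' $ i) \<and> (\<forall>j. g $ j \<le> g' $ j) \<longrightarrow> (f', g') = (f, g)}"

definition distributions_on :: "('m::finite \<times> 'n::finite) set \<Rightarrow> ('m \<times> 'n \<Rightarrow> real) set" where
  "distributions_on E = {\<pi>. (\<forall>e\<in>E. 0 \<le> \<pi> e) \<and> (\<forall>e. e \<notin> E \<longrightarrow> \<pi> e = 0) \<and> (\<Sum>e\<in>E. \<pi> e) = 1}"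

definition marginal_X :: "('m::finite \<times> 'n::finite) set \<Rightarrow> ('m \<times> 'n \<Rightarrow> real) \<Rightarrow> real ^ 'm" where
  "marginal_X E \<pi> = (\<chi> i. \<Sum>j\<in>{j. (i, j) \<in> E}. \<pi> (i, j))"

definition marginal_Y :: "('m::finite \<times> 'n::finite) set \<Rightarrow> ('m \<times> 'n \<Rightarrow> real) \<Rightarrow> real ^ 'n" where
  "marginal_Y E \<pi> = (\<chi> j. \<Sum>i\<in>{i. (i, j) \<in> E}. \<pi> (i, j))"

text \<open>For \<open>\<mu>\<close>, \<open>\<nu>\<close> in the simplex with positive entries and \<open>E\<close> without isolated vertices, the
  minimizers below exist, are unique (strict convexity) and have positive entries. If \<open>E\<close> has an
  isolated vertex, no meaning is attached to them.\<close>

definition mu_star ::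
    "real ^ 'm \<Rightarrow> real ^ 'n \<Rightarrow> ('m::finite \<times> 'n::finite) set \<Rightarrow> real ^ 'm" where
  "mu_star \<mu> \<nu> E = arg_min_on (\<lambda>\<mu>'. rel_entropy \<mu>' \<mu>)
     {\<mu>'. \<exists>Q\<in>distributions_on E. marginal_X E Q = \<mu>' \<and> marginal_Y E Q = \<nu>}"

definition nu_star ::
    "real ^ 'm \<Rightarrow> real ^ 'n \<Rightarrow> ('m::finite \<times> 'n::finite) set \<Rightarrow> real ^ 'n" where
  "nu_star \<mu> \<nu> E = arg_min_on (\<lambda>\<nu>'. rel_entropy \<nu>' \<nu>)
     {\<nu>'. \<exists>P\<in>distributions_on E. marginal_X E P = \<mu> \<and> marginal_Y E P = \<nu>'}"

definition v_star ::
    "real ^ 'm \<Rightarrow> real ^ 'n \<Rightarrow> ('m::finite \<times> 'n::finite) set \<Rightarrow> real ^ 'm" where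
  "v_star \<mu> \<nu> E = (\<chi> i. ln (\<mu> $ i / mu_star \<mu> \<nu> E $ i))"

definition w_star ::
    "real ^ 'm \<Rightarrow> real ^ 'n \<Rightarrow> ('m::finite \<times> 'n::finite) set \<Rightarrow> real ^ 'n" where
  "w_star \<mu> \<nu> E = (\<chi> j. ln (\<nu> $ j / nu_star \<mu> \<nu> E $ j))"

text \<open>First time \<open>s \<ge> t\<close> at which a constraint outside \<open>E\<close> is reached when moving from \<open>(f, g)\<close>
  at time \<open>t\<close> with velocity \<open>(v, w)\<close>. In \<^typ>\<open>ereal\<close> the infimum of the empty set is \<open>\<infinity>\<close>,
  and the maximum over an empty complement of \<open>E\<close> is \<open>-\<infinity>\<close>; over a nonempty (finite) one,
  the supremum is the maximum.\<close>

definition hitting_time :: "real ^ 'n ^ 'm \<Rightarrow> ('m::finite \<times> 'n::finite) set \<Rightarrow>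
    real \<Rightarrow> real ^ 'm \<Rightarrow> real ^ 'n \<Rightarrow> real ^ 'm \<Rightarrow> real ^ 'n \<Rightarrow> ereal" where
  "hitting_time C E t f g v w = Inf {ereal s | s. t \<le> s \<and>
     0 \<le> (SUP (i, j)\<in>-E. ereal (f $ i + g $ j + (s - t) * (v $ i + w $ j) - C $ i $ j))}"

text \<open>The curve \<open>(f, g)\<close> on \<open>[0, \<infinity>)\<close>, with phases \<open>(t l, v l, w l, E l)\<close> for \<open>l \<le> L\<close>, is the cold
  Sinkhorn dynamics started at \<open>(f0, g0)\<close>. The values of \<open>t, v, w, E\<close> at indices above \<open>L\<close> are
  irrelevant; phase \<open>L\<close> lasts forever (\<open>t\<^bsub>L+1\<^esub> = \<infinity>\<close>). The derivative relative to the half-open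
  phase interval is the right derivative at its left end point.\<close>

definition cold_sinkhorn ::
    "real ^ 'm \<Rightarrow> real ^ 'n \<Rightarrow> real ^ 'n ^ 'm \<Rightarrow> real ^ 'm \<Rightarrow> real ^ 'n \<Rightarrow>
     nat \<Rightarrow> (nat \<Rightarrow> real) \<Rightarrow> (nat \<Rightarrow> real ^ 'm) \<Rightarrow> (nat \<Rightarrow> real ^ 'n) \<Rightarrow>
     (nat \<Rightarrow> ('m::finite \<times> 'n::finite) set) \<Rightarrow> (real \<Rightarrow> real ^ 'm) \<Rightarrow> (real \<Rightarrow> real ^ 'n) \<Rightarrow> bool" where
  "cold_sinkhorn \<mu> \<nu> C f0 g0 L t v w E f g \<longleftrightarrow>
     continuous_on {0..} f \<and> continuous_on {0..} g \<and> f 0 = f0 \<and> g 0 = g0 \<and>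
     (\<forall>l\<le>L. \<forall>s\<in>(if l < L then {t l..<t (Suc l)} else {t l..}).
        (f has_vector_derivative v l) (at s within (if l < L then {t l..<t (Suc l)} else {t l..})) \<and>
        (g has_vector_derivative w l) (at s within (if l < L then {t l..<t (Suc l)} else {t l..}))) \<and>
     t 0 = 0 \<and>
     E 0 = {(i, j). f0 $ i + g0 $ j - C $ i $ j = 0} \<and>
     (\<forall>l\<le>L. v l = v_star \<mu> \<nu> (E l) \<and> w l = w_star \<mu> \<nu> (E l)) \<and>
     (\<forall>l<L. hitting_time C (E l) (t l) (f (t l)) (g (t l)) (v l) (w l) = ereal (t (Suc l)) \<and>
        E (Suc l) = {(i, j). f (t l) $ i + g (t l) $ j
                       + (t (Suc l) - t l) * (v l $ i + w l $ j) - C $ i $ j = 0}) \<and>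
     hitting_time C (E L) (t L) (f (t L)) (g (t L)) (v L) (w L) = \<infinity>"

end

theory Submission
  imports Defs "HOL-Real_Asymp.Real_Asymp"
begin

text \<open>Why the last phase starts by a uniform time: the dual objective \<open>\<mu> \<bullet> f + \<nu> \<bullet> g\<close> increases along
  the curve at a speed bounded away from zero until the last phase starts, while its total possible
  increase is bounded in terms of \<open>C\<close> alone.

  During a phase with tight set \<open>E\<close> the objective has derivative \<open>H(\<mu>|\<mu>\<^sup>*(E)) + H(\<nu>|\<nu>\<^sup>*(E))\<close>. It is
  nonnegative and vanishes only if the velocity is zero; but a phase with zero velocity never ends.
  As there are finitely many sets \<open>E\<close>, the derivative is at least some \<open>c > 0\<close> in every phase but the
  last (\<open>dual_rate_bounded_below\<close>). On the feasible polytope the objective is at most \<open>M = max |C\<^sub>i\<^sub>j|\<close>, and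
  on the Pareto frontier it is at least \<open>- 3 M\<close>, as any \<open>f\<^sub>i + g\<^sub>j\<close> is controlled by two tight
  constraints (\<open>pareto_sum_ge\<close>). So \<open>t\<^sub>L \<le> 4 M / c\<close>.

  This needs the curve to stay feasible, and the tight sets to have no isolated vertex, since
  otherwise \<open>\<mu>\<^sup>*\<close> and \<open>\<nu>\<^sup>*\<close> carry no information. Constraints outside \<open>E\<close> are respected by the choice of
  the hitting time. For those in \<open>E\<close>, the essential point is the relation between the two minimization
  problems (\<open>velocity_structure\<close>): one has \<open>w\<^sup>*\<^sub>j = - max {v\<^sup>*\<^sub>i | (i, j) \<in> E}\<close>. Thus \<open>v\<^sup>*\<^sub>i + w\<^sup>*\<^sub>j \<le> 0\<close> on \<open>E\<close>,
  so tight constraints are not crossed, and equality holds on the support of an optimal coupling for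
  \<open>\<mu>\<^sup>*\<close>, so the edges in that support, which cover all vertices, remain tight.\<close>

section \<open>Convexity of the relative entropy\<close>

text \<open>The entropy term \<open>x log (x / p)\<close> lies above its tangents at positive points. The gap is
  \<open>x (y / x - 1 - log (y / x))\<close>, so everything reduces to \<open>log z \<le> z - 1\<close>, with equality only at
  \<open>z = 1\<close>; at \<open>x = 0\<close> the convention \<open>0 log 0 = 0\<close> leaves a gap of \<open>y\<close>.\<close>

lemma entropy_term_above_tangent:
  fixes x y p :: real
  assumes "0 \<le> x" "0 < y" "0 < p"
  shows "y * ln (y / p) + (x - y) * (ln (y / p) + 1) \<le> x * ln (x / p)"
    and "x \<noteq> y \<Longrightarrow> y * ln (y / p) + (x - y) * (ln (y / p) + 1) < x * ln (x / p)"
proof -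
  have split: "x * ln (x / p) - (y * ln (y / p) + (x - y) * (ln (y / p) + 1))
      = x * (y / x - 1 - ln (y / x))" if "0 < x"
    using that assms by (simp add: ln_div algebra_simps)
  show "y * ln (y / p) + (x - y) * (ln (y / p) + 1) \<le> x * ln (x / p)"
  proof (cases "x = 0")
    case True
    then show ?thesis using assms by (simp add: algebra_simps)
  next
    case False
    then have "0 < x" using assms by simp
    moreover have "0 \<le> x * (y / x - 1 - ln (y / x))"
      using \<open>0 < x\<close> assms ln_le_minus_one[of "y / x"] by simp
    ultimately show ?thesis using split by simp
  qed
  show "y * ln (y / p) + (x - y) * (ln (y / p) + 1) < x * ln (x / p)" if "x \<noteq> y"
  proof (cases "x = 0")
    case True
    then show ?thesis using assms by (simp add: algebra_simps)
  next
    case False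
    then have "0 < x" using assms by simp
    moreover have "ln (y / x) < y / x - 1"
      using \<open>0 < x\<close> assms that ln_le_minus_one[of "y / x"] ln_eq_minus_one[of "y / x"]
      by (fastforce simp: order_less_le)
    then have "0 < x * (y / x - 1 - ln (y / x))" using \<open>0 < x\<close> by simp
    ultimately show ?thesis using split by simp
  qed
qed

lemma continuous_on_entropy_term:
  fixes p :: real
  assumes "0 < p"
  shows "continuous_on {0..} (\<lambda>x. x * ln (x / p))"
  unfolding continuous_on_eq_continuous_within
proof
  fix x :: real assume "x \<in> {0..}"
  show "continuous (at x within {0..}) (\<lambda>x. x * ln (x / p))"
  proof (cases "x = 0")
    case True
    have "((\<lambda>x. x * ln (x / p)) \<longlongrightarrow> 0) (at_right 0)"
      using assms by real_asymp
    then show ?thesis using True by (simp add: continuous_within at_within_Ici_at_right)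
  next
    case False
    then show ?thesis using \<open>x \<in> {0..}\<close> assms by (intro continuous_intros) auto
  qed
qed

text \<open>The linear parts \<open>\<Sum> (p\<^sub>i - q\<^sub>i)\<close> of the coordinatewise tangents cancel because the masses agree.
  This strict first-order inequality turns stationarity conditions into unique minimality.\<close>

lemma rel_entropy_above_tangent:
  fixes p q r :: "real ^ 'k"
  assumes "\<And>i. 0 \<le> p $ i" "\<And>i. 0 < q $ i" "\<And>i. 0 < r $ i"
    and mass: "(\<Sum>i\<in>UNIV. p $ i) = (\<Sum>i\<in>UNIV. q $ i)" and "p \<noteq> q"
  shows "rel_entropy q r + (\<Sum>i\<in>UNIV. (p $ i - q $ i) * ln (q $ i / r $ i)) < rel_entropy p r"
proof -
  let ?tan = "\<lambda>i. q $ i * ln (q $ i / r $ i) + (p $ i - q $ i) * (ln (q $ i / r $ i) + 1)"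
  obtain k where "p $ k \<noteq> q $ k" using \<open>p \<noteq> q\<close> by (auto simp: vec_eq_iff)
  have "(\<Sum>i\<in>UNIV. ?tan i) < (\<Sum>i\<in>UNIV. p $ i * ln (p $ i / r $ i))"
  proof (rule sum_strict_mono_ex1)
    show "\<forall>i\<in>UNIV. ?tan i \<le> p $ i * ln (p $ i / r $ i)"
      using entropy_term_above_tangent(1) assms(1-3) by blast
    show "\<exists>i\<in>UNIV. ?tan i < p $ i * ln (p $ i / r $ i)"
      using entropy_term_above_tangent(2)[OF assms(1-3) \<open>p $ k \<noteq> q $ k\<close>] by blast
  qed simp
  moreover have "(\<Sum>i\<in>UNIV. ?tan i)
      = rel_entropy q r + (\<Sum>i\<in>UNIV. (p $ i - q $ i) * ln (q $ i / r $ i))"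
    using mass by (simp add: rel_entropy_def algebra_simps sum.distrib sum_subtractf)
  ultimately show ?thesis by (simp add: rel_entropy_def)
qed

corollary rel_entropy_pos:
  fixes p q :: "real ^ 'k"
  assumes "\<And>i. 0 \<le> p $ i" "\<And>i. 0 < q $ i"
    and "(\<Sum>i\<in>UNIV. p $ i) = (\<Sum>i\<in>UNIV. q $ i)" and "p \<noteq> q"
  shows "0 < rel_entropy p q"
proof -
  have "q $ i / q $ i = 1" for i using assms(2)[of i] by simp
  then show ?thesis
    using rel_entropy_above_tangent[of p q q] assms by (simp add: rel_entropy_def)
qed

text \<open>Moving mass from a coordinate with larger ratio to one with smaller ratio decreases the entropy,
  as long as the move does not reverse the order of the ratios: use the tangents at the new point.
  Since \<open>a = 0\<close> is allowed, this one inequality gives both the stationarity condition and the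
  positivity of the minimizer.\<close>

lemma entropy_decreases_towards_smaller_ratio:
  fixes a b p q e :: real
  assumes "0 \<le> a" "0 < p" "0 < q" "0 < e" "e < b" "(a + e) / p < (b - e) / q"
  shows "(a + e) * ln ((a + e) / p) + (b - e) * ln ((b - e) / q) < a * ln (a / p) + b * ln (b / q)"
proof -
  have "ln ((a + e) / p) < ln ((b - e) / q)" using assms by (subst ln_less_cancel_iff) auto
  then have "e * ln ((a + e) / p) < e * ln ((b - e) / q)" using assms by simp
  moreover have "a * ln ((a + e) / p) \<le> e + a * ln (a / p)"
    using entropy_term_above_tangent(1)[of a "a + e" p] assms(1-5) by (simp add: algebra_simps)
  moreover have "e + b * ln ((b - e) / q) \<le> b * ln (b / q)"
    using entropy_term_above_tangent(1)[of b "b - e" q] assms(1-5) by (simp add: algebra_simps)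
  ultimately show ?thesis unfolding distrib_right left_diff_distrib by linarith
qed

section \<open>Couplings supported on a bipartite graph\<close>

definition no_isolated_vertex :: "('m \<times> 'n) set \<Rightarrow> bool" where
  "no_isolated_vertex E \<longleftrightarrow> (\<forall>i. \<exists>j. (i, j) \<in> E) \<and> (\<forall>j. \<exists>i. (i, j) \<in> E)"

text \<open>Summing over whole rows and columns, with zeros off \<open>E\<close>, avoids the index sets of
  \<^const>\<open>marginal_X\<close> and \<^const>\<open>marginal_Y\<close>. The total mass is not prescribed here, as it is
  fixed by either marginal.\<close>

definition couplings ::
    "('m::finite \<times> 'n::finite) set \<Rightarrow> real ^ 'm \<Rightarrow> real ^ 'n \<Rightarrow> ('m \<times> 'n \<Rightarrow> real) set" where
  "couplings E a b = {Q. (\<forall>e. 0 \<le> Q e) \<and> (\<forall>e. e \<notin> E \<longrightarrow> Q e = 0) \<and>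
     (\<forall>i. (\<Sum>j\<in>UNIV. Q (i, j)) = a $ i) \<and> (\<forall>j. (\<Sum>i\<in>UNIV. Q (i, j)) = b $ j)}"

lemma couplingsD:
  assumes "Q \<in> couplings E a b"
  shows "0 \<le> Q e" "e \<notin> E \<Longrightarrow> Q e = 0"
    "(\<Sum>j\<in>UNIV. Q (i, j)) = a $ i" "(\<Sum>i\<in>UNIV. Q (i, j)) = b $ j"
  using assms unfolding couplings_def by blast+

lemma coupling_mass:
  assumes "Q \<in> couplings E a b"
  shows "(\<Sum>i\<in>UNIV. a $ i) = (\<Sum>j\<in>UNIV. b $ j)"
proof -
  have "(\<Sum>i\<in>UNIV. a $ i) = (\<Sum>i\<in>UNIV. \<Sum>j\<in>UNIV. Q (i, j))"
    using couplingsD(3)[OF assms] by simp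
  also have "\<dots> = (\<Sum>j\<in>UNIV. \<Sum>i\<in>UNIV. Q (i, j))" by (rule sum.swap)
  finally show ?thesis using couplingsD(4)[OF assms] by simp
qed

lemma coupling_entry_le:
  assumes "Q \<in> couplings E a b"
  shows "Q (i, j) \<le> a $ i"
proof -
  have "Q (i, j) \<le> (\<Sum>j\<in>UNIV. Q (i, j))" by (rule member_le_sum) (auto simp: couplingsD[OF assms])
  then show ?thesis by (simp add: couplingsD[OF assms])
qed

lemma coupling_positive_entry:
  assumes "Q \<in> couplings E a b"
  shows "0 < a $ i \<Longrightarrow> \<exists>j. 0 < Q (i, j)" "0 < b $ j \<Longrightarrow> \<exists>i. 0 < Q (i, j)"
proof -
  note le = couplingsD(1)[OF assms, unfolded order_le_less]
  show "\<exists>j. 0 < Q (i, j)" if "0 < a $ i"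
  proof (rule ccontr)
    assume "\<nexists>j. 0 < Q (i, j)"
    then have "(\<Sum>j\<in>UNIV. Q (i, j)) = 0" using le by (intro sum.neutral) metis
    then show False using couplingsD(3)[OF assms] that by simp
  qed
  show "\<exists>i. 0 < Q (i, j)" if "0 < b $ j"
  proof (rule ccontr)
    assume "\<nexists>i. 0 < Q (i, j)"
    then have "(\<Sum>i\<in>UNIV. Q (i, j)) = 0" using le by (intro sum.neutral) metis
    then show False using couplingsD(4)[OF assms] that by simp
  qed
qed

lemma marginal_eq_full_sum:
  assumes "\<And>e. e \<notin> E \<Longrightarrow> Q e = 0"
  shows "marginal_X E Q $ i = (\<Sum>j\<in>UNIV. Q (i, j))" "marginal_Y E Q $ j = (\<Sum>i\<in>UNIV. Q (i, j))"
  using assms by (auto simp: marginal_X_def marginal_Y_def intro!: sum.mono_neutral_left)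

lemma distribution_with_marginals_iff:
  fixes E :: "('m::finite \<times> 'n::finite) set"
  assumes "(\<Sum>i\<in>UNIV. a $ i) = 1 \<or> (\<Sum>j\<in>UNIV. b $ j) = 1"
  shows "Q \<in> distributions_on E \<and> marginal_X E Q = a \<and> marginal_Y E Q = b \<longleftrightarrow> Q \<in> couplings E a b"
proof
  assume "Q \<in> distributions_on E \<and> marginal_X E Q = a \<and> marginal_Y E Q = b"
  then show "Q \<in> couplings E a b"
    using marginal_eq_full_sum[of E Q] by (fastforce simp: couplings_def distributions_on_def)
next
  assume Q: "Q \<in> couplings E a b"
  note D = couplingsD[OF Q]
  have "(\<Sum>e\<in>E. Q e) = (\<Sum>e\<in>UNIV \<times> UNIV. Q e)"
    using D(2) by (intro sum.mono_neutral_left) auto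
  also have "\<dots> = (\<Sum>i\<in>UNIV. \<Sum>j\<in>UNIV. Q (i, j))" by (simp add: sum.cartesian_product)
  finally have "(\<Sum>e\<in>E. Q e) = (\<Sum>i\<in>UNIV. a $ i)" using D(3) by simp
  then have "(\<Sum>e\<in>E. Q e) = 1" using assms coupling_mass[OF Q] by auto
  then show "Q \<in> distributions_on E \<and> marginal_X E Q = a \<and> marginal_Y E Q = b"
    using D marginal_eq_full_sum[of E Q] by (auto simp: distributions_on_def vec_eq_iff)
qed

lemma mu_star_alt:
  assumes "\<nu> \<in> prob_simplex"
  shows "mu_star \<mu> \<nu> E = arg_min (\<lambda>a. rel_entropy a \<mu>) (\<lambda>a. couplings E a \<nu> \<noteq> {})"
proof -
  have "(\<exists>Q\<in>distributions_on E. marginal_X E Q = a \<and> marginal_Y E Q = \<nu>) \<longleftrightarrow> couplings E a \<nu> \<noteq> {}" for a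
    using distribution_with_marginals_iff[of a \<nu> _ E] assms by (auto simp: prob_simplex_def)
  then show ?thesis by (simp add: mu_star_def arg_min_on_def)
qed

lemma nu_star_alt:
  assumes "\<mu> \<in> prob_simplex"
  shows "nu_star \<mu> \<nu> E = arg_min (\<lambda>b. rel_entropy b \<nu>) (\<lambda>b. couplings E \<mu> b \<noteq> {})"
proof -
  have "(\<exists>Q\<in>distributions_on E. marginal_X E Q = \<mu> \<and> marginal_Y E Q = b) \<longleftrightarrow> couplings E \<mu> b \<noteq> {}" for b
    using distribution_with_marginals_iff[of \<mu> b _ E] assms by (auto simp: prob_simplex_def)
  then show ?thesis by (simp add: nu_star_def arg_min_on_def)
qed

section \<open>The minimizer \<open>\<mu>\<^sup>*\<close>\<close>

text \<open>Couplings with prescribed second marginal are represented as vectors so that compactness can be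
  read off from boundedness and closedness.\<close>

lemma compact_couplings_with_column_sums:
  fixes E :: "('m::finite \<times> 'n::finite) set" and \<nu> :: "real ^ 'n"
  shows "compact {q :: real ^ ('m \<times> 'n). (\<forall>e. 0 \<le> q $ e) \<and> (\<forall>e. e \<notin> E \<longrightarrow> q $ e = 0) \<and>
    (\<forall>j. (\<Sum>i\<in>UNIV. q $ (i, j)) = \<nu> $ j)}" (is "compact ?K")
proof -
  have "?K \<subseteq> cbox 0 (\<chi> e. \<nu> $ snd e)"
  proof
    fix q assume q: "q \<in> ?K"
    have "q $ (i, j) \<le> \<nu> $ j" for i j
      using q member_le_sum[of i UNIV "\<lambda>i. q $ (i, j)"] by auto
    then show "q \<in> cbox 0 (\<chi> e. \<nu> $ snd e)" using q by (auto simp: mem_box_cart)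
  qed
  moreover have "closed ?K"
    by (intro closed_Collect_conj closed_Collect_all closed_Collect_imp closed_Collect_le
        closed_Collect_eq continuous_intros open_Collect_const)
  ultimately show ?thesis
    using compact_Int_closed[OF compact_cbox[of 0 "\<chi> e. \<nu> $ snd e"], of ?K]
    by (simp add: Int_absorb1)
qed

text \<open>The minimum is attained: the feasible first marginals are the image of a compact set of couplings
  under taking row sums, and this set is nonempty since every column has an entry in \<open>E\<close> that can
  carry its whole mass.\<close>

lemma mu_star_minimizes:
  fixes \<mu> :: "real ^ 'm" and \<nu> :: "real ^ 'n"
  assumes "\<And>i. 0 < \<mu> $ i" "\<nu> \<in> prob_simplex" and E: "\<And>j. \<exists>i. (i, j) \<in> E"
  shows "couplings E (mu_star \<mu> \<nu> E) \<nu> \<noteq> {}"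
    and "Q \<in> couplings E a \<nu> \<Longrightarrow> rel_entropy (mu_star \<mu> \<nu> E) \<mu> \<le> rel_entropy a \<mu>"
proof -
  define K where "K = {q :: real ^ ('m \<times> 'n). (\<forall>e. 0 \<le> q $ e) \<and> (\<forall>e. e \<notin> E \<longrightarrow> q $ e = 0) \<and>
    (\<forall>j. (\<Sum>i\<in>UNIV. q $ (i, j)) = \<nu> $ j)}"
  define row :: "real ^ ('m \<times> 'n) \<Rightarrow> real ^ 'm" where "row = (\<lambda>q. \<chi> i. \<Sum>j\<in>UNIV. q $ (i, j))"
  have "compact K" unfolding K_def by (rule compact_couplings_with_column_sums)
  moreover have "K \<noteq> {}"
  proof -
    obtain r where r: "\<And>j. (r j, j) \<in> E" using E by metis
    have "(\<Sum>i\<in>UNIV. if i = r j then \<nu> $ j else 0) = \<nu> $ j" for j by simp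
    then have "(\<chi> e. if fst e = r (snd e) then \<nu> $ snd e else 0) \<in> K"
      using assms(2) r by (auto simp: K_def prob_simplex_def)
    then show ?thesis by blast
  qed
  moreover have "continuous_on K (\<lambda>q. rel_entropy (row q) \<mu>)"
  proof -
    have "continuous_on K (\<lambda>q. \<Sum>i\<in>UNIV. (\<lambda>x. x * ln (x / \<mu> $ i)) (row q $ i))"
    proof (intro continuous_on_sum)
      fix i
      have "continuous_on K (\<lambda>q. row q $ i)" unfolding row_def by (simp, intro continuous_intros)
      moreover have "(\<lambda>q. row q $ i) ` K \<subseteq> {0..}"
        by (auto simp: row_def K_def intro!: sum_nonneg)
      ultimately show "continuous_on K (\<lambda>q. (\<lambda>x. x * ln (x / \<mu> $ i)) (row q $ i))"
        by (rule continuous_on_compose2[OF continuous_on_entropy_term[OF assms(1)]])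
    qed
    then show ?thesis by (simp add: rel_entropy_def)
  qed
  ultimately obtain q where "q \<in> K" and q: "\<And>q'. q' \<in> K \<Longrightarrow> rel_entropy (row q) \<mu> \<le> rel_entropy (row q') \<mu>"
    using continuous_attains_inf by metis
  have feasible: "couplings E (row q) \<nu> \<noteq> {}"
  proof -
    have "(\<lambda>e. q $ e) \<in> couplings E (row q) \<nu>"
      using \<open>q \<in> K\<close> by (simp add: couplings_def K_def row_def)
    then show ?thesis by blast
  qed
  have minimal: "rel_entropy (row q) \<mu> \<le> rel_entropy a \<mu>" if "couplings E a \<nu> \<noteq> {}" for a
  proof -
    obtain Q where Q: "Q \<in> couplings E a \<nu>" using \<open>couplings E a \<nu> \<noteq> {}\<close> by blast
    then have "(\<chi> e. Q e) \<in> K" by (simp add: couplings_def K_def)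
    moreover have "row (\<chi> e. Q e) = a" using Q by (simp add: couplings_def row_def vec_eq_iff)
    ultimately show ?thesis using q by metis
  qed
  have "couplings E (mu_star \<mu> \<nu> E) \<nu> \<noteq> {} \<and>
      (\<forall>a. couplings E a \<nu> \<noteq> {} \<longrightarrow> rel_entropy (mu_star \<mu> \<nu> E) \<mu> \<le> rel_entropy a \<mu>)"
    unfolding mu_star_alt[OF assms(2)]
    proof (rule arg_minI[where x = "row q"])
    show "\<not> rel_entropy a \<mu> < rel_entropy (row q) \<mu>" if "couplings E a \<nu> \<noteq> {}" for a
      using minimal[OF that] by simp
  qed (use feasible in \<open>auto simp: not_less\<close>)
  then show "couplings E (mu_star \<mu> \<nu> E) \<nu> \<noteq> {}"
    and "Q \<in> couplings E a \<nu> \<Longrightarrow> rel_entropy (mu_star \<mu> \<nu> E) \<mu> \<le> rel_entropy a \<mu>"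
    by auto
qed

text \<open>First-order optimality: if the mass that column \<open>j\<close> puts in row \<open>i\<close> could be moved within the
  column to a row \<open>k\<close> of smaller ratio, the entropy would drop. Hence each column uses only those of
  its neighbouring rows for which \<open>\<mu>\<^sup>*\<^sub>i / \<mu>\<^sub>i\<close> is smallest, that is, for which \<open>v\<^sup>*\<^sub>i\<close> is largest.\<close>

lemma mu_star_ratio_minimal_on_support:
  fixes \<mu> :: "real ^ 'm" and \<nu> :: "real ^ 'n"
  assumes "\<And>i. 0 < \<mu> $ i" "\<nu> \<in> prob_simplex" "\<And>j. \<exists>i. (i, j) \<in> E"
    and Q: "Q \<in> couplings E (mu_star \<mu> \<nu> E) \<nu>" and "0 < Q (i, j)" and "(k, j) \<in> E"
  shows "mu_star \<mu> \<nu> E $ i / \<mu> $ i \<le> mu_star \<mu> \<nu> E $ k / \<mu> $ k"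
proof (rule ccontr)
  define a where "a = mu_star \<mu> \<nu> E"
  assume "\<not> ?thesis"
  then have less: "a $ k / \<mu> $ k < a $ i / \<mu> $ i" by (simp add: a_def)
  then have "k \<noteq> i" by auto
  note Qa = Q[folded a_def]
  have "0 \<le> a $ l" for l using couplingsD[OF Qa] sum_nonneg[of UNIV "\<lambda>j. Q (l, j)"] by simp
  \<comment> \<open>An amount \<open>e\<close> small enough to be available and to keep the order of the ratios.\<close>
  obtain e where "0 < e" "e < Q (i, j)" and e: "(a $ k + e) / \<mu> $ k < (a $ i - e) / \<mu> $ i"
  proof -
    have "((\<lambda>e. (a $ i - e) / \<mu> $ i - (a $ k + e) / \<mu> $ k) \<longlongrightarrow>
        (a $ i - 0) / \<mu> $ i - (a $ k + 0) / \<mu> $ k) (at_right 0)"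
      using assms(1) by (intro tendsto_intros) (auto simp: less_imp_neq[symmetric])
    then have "\<forall>\<^sub>F e in at_right 0. 0 < (a $ i - e) / \<mu> $ i - (a $ k + e) / \<mu> $ k"
      using less by (intro order_tendstoD(1)) auto
    moreover have "\<forall>\<^sub>F e in at_right 0. 0 < e \<and> e < Q (i, j)"
      using \<open>0 < Q (i, j)\<close> by (intro eventually_at_rightI[of 0 "Q (i, j)"]) auto
    ultimately have "\<forall>\<^sub>F e in at_right 0. 0 < e \<and> e < Q (i, j) \<and>
        (a $ k + e) / \<mu> $ k < (a $ i - e) / \<mu> $ i"
      by eventually_elim auto
    then show ?thesis using that eventually_happens trivial_limit_at_right_real by blast
  qed
  define a' where "a' = (\<chi> l. a $ l + (if l = k then e else 0) - (if l = i then e else 0))"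
  define Q' where "Q' = (\<lambda>x. Q x + (if x = (k, j) then e else 0) - (if x = (i, j) then e else 0))"
  have "Q' \<in> couplings E a' \<nu>"
  proof -
    have "(i, j) \<in> E" using couplingsD(2)[OF Qa, of "(i, j)"] \<open>0 < Q (i, j)\<close> by force
    have "(\<Sum>j'\<in>UNIV. Q' (l, j')) = a' $ l" for l
      using \<open>k \<noteq> i\<close> couplingsD(3)[OF Qa, of l]
      by (auto simp: Q'_def a'_def sum.distrib sum_subtractf)
    moreover have "(\<Sum>l\<in>UNIV. Q' (l, j')) = \<nu> $ j'" for j'
      using couplingsD(4)[OF Qa, of j']
      by (cases "j' = j") (auto simp: Q'_def sum.distrib sum_subtractf)
    moreover have "0 \<le> Q' x" for x
      using couplingsD(1)[OF Qa, of x] \<open>0 < e\<close> \<open>e < Q (i, j)\<close> by (auto simp: Q'_def)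
    moreover have "Q' x = 0" if "x \<notin> E" for x
      using couplingsD(2)[OF Qa, of x] that \<open>(i, j) \<in> E\<close> \<open>(k, j) \<in> E\<close> by (auto simp: Q'_def)
    ultimately show ?thesis by (simp add: couplings_def)
  qed
  then have "rel_entropy a \<mu> \<le> rel_entropy a' \<mu>"
    unfolding a_def by (rule mu_star_minimizes(2)[OF assms(1-3)])
  moreover have "rel_entropy a' \<mu> < rel_entropy a \<mu>"
  proof -
    have split: "rel_entropy p \<mu> = p $ k * ln (p $ k / \<mu> $ k) + p $ i * ln (p $ i / \<mu> $ i)
        + (\<Sum>l\<in>UNIV - {k, i}. p $ l * ln (p $ l / \<mu> $ l))" for p
      using \<open>k \<noteq> i\<close> unfolding rel_entropy_def
      by (subst sum.subset_diff[of "{k, i}"]) auto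
    have "e < a $ i" using \<open>e < Q (i, j)\<close> coupling_entry_le[OF Qa, of i j] by simp
    moreover have "(\<Sum>l\<in>UNIV - {k, i}. a' $ l * ln (a' $ l / \<mu> $ l))
        = (\<Sum>l\<in>UNIV - {k, i}. a $ l * ln (a $ l / \<mu> $ l))"
      by (intro sum.cong) (auto simp: a'_def)
    moreover have "a' $ k = a $ k + e" "a' $ i = a $ i - e"
      using \<open>k \<noteq> i\<close> by (auto simp: a'_def)
    ultimately show ?thesis
      using entropy_decreases_towards_smaller_ratio[OF \<open>0 \<le> a $ k\<close> assms(1) assms(1) \<open>0 < e\<close> _ e]
      unfolding split[of a'] split[of a] by simp
  qed
  ultimately show False by simp
qed

text \<open>A row \<open>k\<close> has a neighbouring column, and that column already feeds a row with positive ratio;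
  by optimality the ratio of row \<open>k\<close> is at least as large.\<close>

lemma mu_star_pos:
  fixes \<mu> :: "real ^ 'm" and \<nu> :: "real ^ 'n"
  assumes "\<And>i. 0 < \<mu> $ i" "\<nu> \<in> prob_simplex" "\<And>j. 0 < \<nu> $ j" and E: "no_isolated_vertex E"
  shows "0 < mu_star \<mu> \<nu> E $ k"
proof -
  have cols: "\<exists>i. (i, j) \<in> E" for j using E by (auto simp: no_isolated_vertex_def)
  obtain Q where Q: "Q \<in> couplings E (mu_star \<mu> \<nu> E) \<nu>"
    using mu_star_minimizes(1)[OF assms(1,2) cols] by blast
  obtain j where "(k, j) \<in> E" using E by (auto simp: no_isolated_vertex_def)
  obtain i where "0 < Q (i, j)" using coupling_positive_entry(2)[OF Q] assms(3) by blast
  have "0 < mu_star \<mu> \<nu> E $ i / \<mu> $ i"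
    using \<open>0 < Q (i, j)\<close> coupling_entry_le[OF Q, of i j] assms(1) by (intro divide_pos_pos) auto
  also have "\<dots> \<le> mu_star \<mu> \<nu> E $ k / \<mu> $ k"
    by (rule mu_star_ratio_minimal_on_support[OF assms(1,2) cols Q \<open>0 < Q (i, j)\<close> \<open>(k, j) \<in> E\<close>])
  finally show ?thesis using assms(1)[of k] by (simp add: zero_less_divide_iff not_less_iff_gr_or_eq)
qed

section \<open>Duality between \<open>\<mu>\<^sup>*\<close> and \<open>\<nu>\<^sup>*\<close>\<close>

text \<open>A certificate of optimality for \<open>\<nu>\<^sup>*\<close>. The function \<open>\<phi>\<close> is the gradient of the entropy at the
  candidate \<open>b\<^sub>j = \<nu>\<^sub>j exp \<phi>\<^sub>j\<close>, up to an additive constant. For any competing coupling \<open>R\<close> with first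
  marginal \<open>\<mu>\<close>, integrating \<open>\<phi>\<^sub>j\<close> gives at least the integral of \<open>u\<^sub>i\<close>, which depends on \<open>\<mu>\<close> only and
  is attained by \<open>P\<close>. So the entropy cannot decrease to first order, and strict convexity does the
  rest.\<close>

lemma nu_star_eqI:
  fixes \<mu> :: "real ^ 'm" and \<nu> :: "real ^ 'n"
  assumes \<mu>: "\<mu> \<in> prob_simplex" and "\<And>j. 0 < \<nu> $ j"
    and P: "P \<in> couplings E \<mu> (\<chi> j. \<nu> $ j * exp (\<phi> j))"
    and le: "\<And>i j. (i, j) \<in> E \<Longrightarrow> u i \<le> \<phi> j"
    and eq: "\<And>i j. 0 < P (i, j) \<Longrightarrow> u i = \<phi> j"
  shows "nu_star \<mu> \<nu> E = (\<chi> j. \<nu> $ j * exp (\<phi> j))"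
proof -
  define b where "b = (\<chi> j. \<nu> $ j * exp (\<phi> j))"
  note Pb = P[folded b_def]
  have b: "0 < b $ j" "ln (b $ j / \<nu> $ j) = \<phi> j" for j
    using assms(2)[of j] by (auto simp: b_def)
  have swap: "(\<Sum>j\<in>UNIV. c $ j * \<phi> j) = (\<Sum>i\<in>UNIV. \<Sum>j\<in>UNIV. R (i, j) * \<phi> j)"
    "(\<Sum>i\<in>UNIV. \<mu> $ i * u i) = (\<Sum>i\<in>UNIV. \<Sum>j\<in>UNIV. R (i, j) * u i)"
    if R: "R \<in> couplings E \<mu> c" for R c
  proof -
    have "(\<Sum>j\<in>UNIV. c $ j * \<phi> j) = (\<Sum>j\<in>UNIV. \<Sum>i\<in>UNIV. R (i, j) * \<phi> j)"
      unfolding couplingsD(4)[OF R, symmetric] by (simp add: sum_distrib_right)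
    also have "\<dots> = (\<Sum>i\<in>UNIV. \<Sum>j\<in>UNIV. R (i, j) * \<phi> j)" by (rule sum.swap)
    finally show "(\<Sum>j\<in>UNIV. c $ j * \<phi> j) = (\<Sum>i\<in>UNIV. \<Sum>j\<in>UNIV. R (i, j) * \<phi> j)" .
    show "(\<Sum>i\<in>UNIV. \<mu> $ i * u i) = (\<Sum>i\<in>UNIV. \<Sum>j\<in>UNIV. R (i, j) * u i)"
      unfolding couplingsD(3)[OF R, symmetric] by (simp add: sum_distrib_right)
  qed
  have "rel_entropy b \<nu> < rel_entropy c \<nu>" if R: "R \<in> couplings E \<mu> c" and "c \<noteq> b" for R c
  proof -
    have "(\<Sum>j\<in>UNIV. b $ j * \<phi> j) = (\<Sum>i\<in>UNIV. \<mu> $ i * u i)"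
      unfolding swap[OF Pb]
    proof (intro sum.cong refl)
      fix i j
      show "P (i, j) * \<phi> j = P (i, j) * u i"
        using eq[of i j] couplingsD(1)[OF P, of "(i, j)"] by (cases "P (i, j) = 0") auto
    qed
    also have "\<dots> \<le> (\<Sum>j\<in>UNIV. c $ j * \<phi> j)"
      unfolding swap[OF R]
    proof (intro sum_mono)
      fix i j
      show "R (i, j) * u i \<le> R (i, j) * \<phi> j"
        using le[of i j] couplingsD(1,2)[OF R, of "(i, j)"]
        by (cases "(i, j) \<in> E") (auto intro: mult_left_mono)
    qed
    finally have "0 \<le> (\<Sum>j\<in>UNIV. (c $ j - b $ j) * ln (b $ j / \<nu> $ j))"
      by (simp add: b left_diff_distrib sum_subtractf)
    moreover have "0 \<le> c $ j" for j
      using couplingsD[OF R] sum_nonneg[of UNIV "\<lambda>i. R (i, j)"] by simp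
    then have "rel_entropy b \<nu> + (\<Sum>j\<in>UNIV. (c $ j - b $ j) * ln (b $ j / \<nu> $ j)) < rel_entropy c \<nu>"
      using coupling_mass[OF R] coupling_mass[OF Pb] \<open>c \<noteq> b\<close> assms(2) b(1)
      by (intro rel_entropy_above_tangent) auto
    ultimately show ?thesis by simp
  qed
  note strict = this
  have "nu_star \<mu> \<nu> E = b"
    unfolding nu_star_alt[OF \<mu>]
  proof (rule arg_minI[where x = b])
    show "couplings E \<mu> b \<noteq> {}" using Pb by blast
    show "\<not> rel_entropy c \<nu> < rel_entropy b \<nu>" if "couplings E \<mu> c \<noteq> {}" for c
      using strict that by fastforce
    show "c = b" if "couplings E \<mu> c \<noteq> {}"
      "\<forall>y. couplings E \<mu> y \<noteq> {} \<longrightarrow> \<not> rel_entropy y \<nu> < rel_entropy c \<nu>" for c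
      using strict that Pb by fastforce
  qed
  then show ?thesis by (simp add: b_def)
qed

text \<open>The two minimization problems are dual to each other. Let \<open>Q\<close> be an optimal coupling for \<open>\<mu>\<^sup>*\<close> and
  \<open>\<phi>\<^sub>j\<close> the largest \<open>v\<^sup>*\<^sub>i\<close> among the neighbours \<open>i\<close> of \<open>j\<close>. Since \<open>Q\<close> is supported where this maximum
  is attained, rescaling its rows by \<open>exp v\<^sup>*\<^sub>i\<close> is the same as rescaling its columns by \<open>exp \<phi>\<^sub>j\<close>. The
  rescaled coupling has first marginal \<open>\<mu>\<close> and certifies that \<open>\<nu>\<^sup>*\<^sub>j = \<nu>\<^sub>j exp \<phi>\<^sub>j\<close>, so \<open>w\<^sup>* = - \<phi>\<close>. Hence
  \<open>v\<^sup>*\<^sub>i + w\<^sup>*\<^sub>j \<le> 0\<close> on \<open>E\<close>, with equality on the support of \<open>Q\<close>, which meets all rows and columns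
  because both marginals of \<open>Q\<close> are positive. In the dynamics this says that tight constraints never
  become violated and that enough of them stay tight.\<close>

lemma velocity_structure:
  fixes \<mu> :: "real ^ 'm" and \<nu> :: "real ^ 'n"
  assumes \<mu>: "\<mu> \<in> prob_simplex" "\<And>i. 0 < \<mu> $ i" and \<nu>: "\<nu> \<in> prob_simplex" "\<And>j. 0 < \<nu> $ j"
    and E: "no_isolated_vertex E"
  shows "(i, j) \<in> E \<Longrightarrow> v_star \<mu> \<nu> E $ i + w_star \<mu> \<nu> E $ j \<le> 0"
    and "no_isolated_vertex {(i, j) \<in> E. v_star \<mu> \<nu> E $ i + w_star \<mu> \<nu> E $ j = 0}"
    and "0 < nu_star \<mu> \<nu> E $ j"
    and "(\<Sum>i\<in>UNIV. mu_star \<mu> \<nu> E $ i) = (\<Sum>i\<in>UNIV. \<mu> $ i)"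
    and "(\<Sum>j\<in>UNIV. nu_star \<mu> \<nu> E $ j) = (\<Sum>j\<in>UNIV. \<nu> $ j)"
proof -
  have cols: "\<exists>i. (i, j) \<in> E" for j using E by (auto simp: no_isolated_vertex_def)
  define a where "a = mu_star \<mu> \<nu> E"
  define v where "v = v_star \<mu> \<nu> E"
  obtain Q where Q: "Q \<in> couplings E a \<nu>"
    using mu_star_minimizes(1)[OF \<mu>(2) \<nu>(1) cols] by (auto simp: a_def)
  have a: "0 < a $ i" for i unfolding a_def by (rule mu_star_pos[OF \<mu>(2) \<nu> E])
  have v: "v $ i = ln (\<mu> $ i) - ln (a $ i)" for i
    using a[of i] \<mu>(2)[of i] by (simp add: v_def v_star_def a_def ln_div)
  have maximal: "v $ k \<le> v $ i" if "0 < Q (i, j)" "(k, j) \<in> E" for i j k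
  proof -
    have "a $ i / \<mu> $ i \<le> a $ k / \<mu> $ k"
      using mu_star_ratio_minimal_on_support[OF \<mu>(2) \<nu>(1) cols Q[unfolded a_def] that]
      by (simp add: a_def)
    then have "ln (a $ i / \<mu> $ i) \<le> ln (a $ k / \<mu> $ k)" using a \<mu>(2) by simp
    moreover have "ln (a $ l / \<mu> $ l) = - v $ l" for l
      using a[of l] \<mu>(2)[of l] by (simp add: v ln_div)
    ultimately show ?thesis by simp
  qed
  have supp: "(i, j) \<in> E" if "0 < Q (i, j)" for i j
    using couplingsD(2)[OF Q, of "(i, j)"] that by force
  obtain r where r: "\<And>j. 0 < Q (r j, j)" using coupling_positive_entry(2)[OF Q] \<nu>(2) by metis
  \<comment> \<open>Any row used by column \<open>j\<close> realizes the maximum of \<open>v\<close> over the neighbours of \<open>j\<close>.\<close>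
  define \<phi> where "\<phi> = (\<lambda>j. v $ r j)"
  have le: "v $ i \<le> \<phi> j" if "(i, j) \<in> E" for i j
    using maximal[OF r that] by (simp add: \<phi>_def)
  have eq: "v $ i = \<phi> j" if "0 < Q (i, j)" for i j
    using le[OF supp[OF that]] maximal[OF that supp[OF r]] by (simp add: \<phi>_def)
  define P where "P = (\<lambda>(i, j). Q (i, j) * exp (v $ i))"
  have P_eq: "P (i, j) = Q (i, j) * exp (\<phi> j)" for i j
    using eq[of i j] couplingsD(1)[OF Q, of "(i, j)"] by (cases "Q (i, j) = 0") (auto simp: P_def)
  have P: "P \<in> couplings E \<mu> (\<chi> j. \<nu> $ j * exp (\<phi> j))"
  proof -
    have "(\<Sum>j\<in>UNIV. P (i, j)) = \<mu> $ i" for i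
    proof -
      have "(\<Sum>j\<in>UNIV. P (i, j)) = a $ i * exp (v $ i)"
        by (simp add: P_def sum_distrib_right[symmetric] couplingsD(3)[OF Q])
      also have "\<dots> = \<mu> $ i" using a[of i] \<mu>(2)[of i] by (simp add: v exp_diff)
      finally show ?thesis .
    qed
    moreover have "(\<Sum>i\<in>UNIV. P (i, j)) = \<nu> $ j * exp (\<phi> j)" for j
      by (simp add: P_eq sum_distrib_right[symmetric] couplingsD(4)[OF Q])
    ultimately show ?thesis
      using couplingsD(1,2)[OF Q] by (auto simp: couplings_def P_def)
  qed
  moreover have "0 < P (i, j) \<longleftrightarrow> 0 < Q (i, j)" for i j
    by (simp add: P_def zero_less_mult_iff)
  ultimately have nu_star: "nu_star \<mu> \<nu> E = (\<chi> j. \<nu> $ j * exp (\<phi> j))"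
    using le eq by (intro nu_star_eqI[OF \<mu>(1) \<nu>(2)]) auto
  then have w: "w_star \<mu> \<nu> E $ j = - \<phi> j" for j
    using \<nu>(2)[of j] by (simp add: w_star_def ln_div ln_mult)
  show "0 < nu_star \<mu> \<nu> E $ j" using \<nu>(2) by (simp add: nu_star)
  have "(\<Sum>i\<in>UNIV. a $ i) = 1" "(\<Sum>j\<in>UNIV. nu_star \<mu> \<nu> E $ j) = 1"
    using coupling_mass[OF Q] coupling_mass[OF P] \<mu>(1) \<nu>(1) by (simp_all add: nu_star prob_simplex_def)
  then show "(\<Sum>i\<in>UNIV. mu_star \<mu> \<nu> E $ i) = (\<Sum>i\<in>UNIV. \<mu> $ i)"
    "(\<Sum>j\<in>UNIV. nu_star \<mu> \<nu> E $ j) = (\<Sum>j\<in>UNIV. \<nu> $ j)"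
    using \<mu>(1) \<nu>(1) by (simp_all add: a_def prob_simplex_def)
  show "v_star \<mu> \<nu> E $ i + w_star \<mu> \<nu> E $ j \<le> 0" if "(i, j) \<in> E"
    using le[OF that] by (simp add: w v_def)
  have "v_star \<mu> \<nu> E $ i + w_star \<mu> \<nu> E $ j = 0" if "0 < Q (i, j)" for i j
    using eq[OF that] by (simp add: w v_def)
  moreover have "\<exists>j. 0 < Q (i, j)" "\<exists>i. 0 < Q (i, j)" for i j
    using coupling_positive_entry[OF Q] a \<nu>(2) by blast+
  ultimately show "no_isolated_vertex {(i, j) \<in> E. v_star \<mu> \<nu> E $ i + w_star \<mu> \<nu> E $ j = 0}"
    using supp unfolding no_isolated_vertex_def by fast
qed

section \<open>Growth of the dual objective\<close>

text \<open>The derivative of the dual objective \<open>\<mu> \<bullet> f + \<nu> \<bullet> g\<close> during a phase with tight set \<open>E\<close>.\<close>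

definition dual_rate :: "real ^ 'm \<Rightarrow> real ^ 'n \<Rightarrow> ('m::finite \<times> 'n::finite) set \<Rightarrow> real" where
  "dual_rate \<mu> \<nu> E = \<mu> \<bullet> v_star \<mu> \<nu> E + \<nu> \<bullet> w_star \<mu> \<nu> E"

text \<open>By definition of the velocities, the rate is \<open>H(\<mu>|\<mu>\<^sup>*) + H(\<nu>|\<nu>\<^sup>*)\<close>, a sum of two relative
  entropies that vanishes only if \<open>\<mu>\<^sup>* = \<mu>\<close> and \<open>\<nu>\<^sup>* = \<nu>\<close>, in which case nothing moves.\<close>

lemma dual_rate_pos:
  fixes \<mu> :: "real ^ 'm" and \<nu> :: "real ^ 'n"
  assumes "\<mu> \<in> prob_simplex" "\<And>i. 0 < \<mu> $ i" "\<nu> \<in> prob_simplex" "\<And>j. 0 < \<nu> $ j"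
    and "no_isolated_vertex E" and moving: "v_star \<mu> \<nu> E \<noteq> 0 \<or> w_star \<mu> \<nu> E \<noteq> 0"
  shows "0 < dual_rate \<mu> \<nu> E"
proof -
  have rate: "dual_rate \<mu> \<nu> E = rel_entropy \<mu> (mu_star \<mu> \<nu> E) + rel_entropy \<nu> (nu_star \<mu> \<nu> E)"
    by (simp add: dual_rate_def inner_vec_def rel_entropy_def v_star_def w_star_def)
  have X: "mu_star \<mu> \<nu> E \<noteq> \<mu> \<Longrightarrow> 0 < rel_entropy \<mu> (mu_star \<mu> \<nu> E)"
    using mu_star_pos[OF assms(2-5)] velocity_structure(4)[OF assms(1-5)] assms(2)
    by (intro rel_entropy_pos) (auto intro: less_imp_le)
  have Y: "nu_star \<mu> \<nu> E \<noteq> \<nu> \<Longrightarrow> 0 < rel_entropy \<nu> (nu_star \<mu> \<nu> E)"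
    using velocity_structure(3,5)[OF assms(1-5)] assms(4)
    by (intro rel_entropy_pos) (auto intro: less_imp_le)
  have self: "rel_entropy \<mu> \<mu> = 0" "rel_entropy \<nu> \<nu> = 0"
    using assms(2,4) by (auto simp: rel_entropy_def less_imp_neq[symmetric])
  have "mu_star \<mu> \<nu> E \<noteq> \<mu> \<or> nu_star \<mu> \<nu> E \<noteq> \<nu>"
  proof (rule ccontr)
    assume "\<not> ?thesis"
    then have "v_star \<mu> \<nu> E = 0" "w_star \<mu> \<nu> E = 0"
      using assms(2,4) by (auto simp: v_star_def w_star_def vec_eq_iff less_imp_neq[symmetric])
    then show False using moving by simp
  qed
  then show ?thesis using X Y self rate by (smt (verit))
qed

text \<open>There are only finitely many edge sets, so only finitely many rates.\<close>

lemma dual_rate_bounded_below: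
  fixes \<mu> :: "real ^ 'm" and \<nu> :: "real ^ 'n"
  assumes "\<mu> \<in> prob_simplex" "\<And>i. 0 < \<mu> $ i" "\<nu> \<in> prob_simplex" "\<And>j. 0 < \<nu> $ j"
  obtains c where "0 < c" and "\<And>E. no_isolated_vertex E \<Longrightarrow>
    v_star \<mu> \<nu> E \<noteq> 0 \<or> w_star \<mu> \<nu> E \<noteq> 0 \<Longrightarrow> c \<le> dual_rate \<mu> \<nu> E"
proof -
  define R where "R = {r \<in> range (dual_rate \<mu> \<nu>). 0 < r}"
  have "finite R" by (simp add: R_def)
  then have "Min (insert 1 R) \<le> r" if "r \<in> R" for r using that by simp
  moreover have "0 < Min (insert 1 R)" using \<open>finite R\<close> by (simp add: R_def)
  ultimately show ?thesis
    using that[of "Min (insert 1 R)"] dual_rate_pos[OF assms] by (auto simp: R_def)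
qed

text \<open>The dual objective is the average of \<open>f\<^sub>i + g\<^sub>j\<close> under the product distribution of \<open>\<mu>\<close> and \<open>\<nu>\<close>.\<close>

lemma dual_value_le:
  fixes \<mu> :: "real ^ 'm" and \<nu> :: "real ^ 'n"
  assumes "\<mu> \<in> prob_simplex" "\<nu> \<in> prob_simplex" and M: "\<And>i j. f $ i + g $ j \<le> M"
  shows "\<mu> \<bullet> f + \<nu> \<bullet> g \<le> M"
proof -
  have one: "(\<Sum>i\<in>UNIV. \<mu> $ i) = 1" "(\<Sum>j\<in>UNIV. \<nu> $ j) = 1"
    and nonneg: "\<And>i. 0 \<le> \<mu> $ i" "\<And>j. 0 \<le> \<nu> $ j"
    using assms(1,2) by (auto simp: prob_simplex_def)
  have "f $ i + \<nu> \<bullet> g \<le> M" for i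
  proof -
    have "f $ i + \<nu> \<bullet> g = (\<Sum>j\<in>UNIV. \<nu> $ j * (f $ i + g $ j))"
      by (simp add: inner_vec_def distrib_left sum.distrib sum_distrib_right[symmetric] one)
    also have "\<dots> \<le> (\<Sum>j\<in>UNIV. \<nu> $ j * M)"
      using nonneg M by (intro sum_mono mult_left_mono) auto
    finally show ?thesis by (simp add: sum_distrib_right[symmetric] one)
  qed
  note row = this
  have "\<mu> \<bullet> f + \<nu> \<bullet> g = (\<Sum>i\<in>UNIV. \<mu> $ i * (f $ i + \<nu> \<bullet> g))"
    by (simp add: inner_vec_def[of \<mu>] distrib_left sum.distrib sum_distrib_right[symmetric] one)
  also have "\<dots> \<le> (\<Sum>i\<in>UNIV. \<mu> $ i * M)"
    using nonneg row by (intro sum_mono mult_left_mono) auto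
  finally show ?thesis by (simp add: sum_distrib_right[symmetric] one)
qed

section \<open>The Pareto frontier\<close>

definition tight :: "real ^ 'n ^ 'm \<Rightarrow> real ^ 'm \<Rightarrow> real ^ 'n \<Rightarrow> ('m \<times> 'n) set" where
  "tight C f g = {(i, j). f $ i + g $ j - C $ i $ j = 0}"

text \<open>If all constraints through a row or a column were slack, the corresponding coordinate could be
  increased by the smallest slack.\<close>

lemma pareto_no_isolated_vertex:
  fixes C :: "real ^ 'n ^ 'm"
  assumes P: "(f, g) \<in> pareto_frontier C"
  shows "no_isolated_vertex (tight C f g)"
proof -
  have feas: "f $ i + g $ j \<le> C $ i $ j" for i j
    using P by (auto simp: pareto_frontier_def dual_polytope_def)
  have maximal: "f' = f \<and> g' = g"
    if "\<And>i j. f' $ i + g' $ j \<le> C $ i $ j" "\<And>i. f $ i \<le> f' $ i" "\<And>j. g $ j \<le> g' $ j" for f' g'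
  proof -
    have "\<forall>f' g'. (\<forall>i j. f' $ i + g' $ j \<le> C $ i $ j) \<longrightarrow>
        (\<forall>i. f $ i \<le> f' $ i) \<and> (\<forall>j. g $ j \<le> g' $ j) \<longrightarrow> f' = f \<and> g' = g"
      using P by (simp add: pareto_frontier_def dual_polytope_def split_beta)
    then show ?thesis using that by blast
  qed
  have "\<exists>j. (i, j) \<in> tight C f g" for i
  proof (rule ccontr)
    assume none: "\<not> ?thesis"
    have slack: "0 < C $ i $ j - f $ i - g $ j" for j
    proof -
      have "(i, j) \<notin> tight C f g" using none by blast
      then show ?thesis using feas[of i j] by (simp add: tight_def)
    qed
    define d where "d = Min (range (\<lambda>j. C $ i $ j - f $ i - g $ j))"
    have "0 < d" using slack by (simp add: d_def)
    have d: "d \<le> C $ i $ j - f $ i - g $ j" for j by (simp add: d_def)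
    define f' where "f' = (\<chi> k. if k = i then f $ k + d else f $ k)"
    have "f' $ k + g $ j \<le> C $ k $ j" for k j
      using feas[of k j] d[of j] by (auto simp: f'_def)
    then have "f' = f" using maximal[of f' g] \<open>0 < d\<close> by (simp add: f'_def)
    then have "f' $ i = f $ i" by simp
    then show False using \<open>0 < d\<close> by (simp add: f'_def)
  qed
  moreover have "\<exists>i. (i, j) \<in> tight C f g" for j
  proof (rule ccontr)
    assume none: "\<not> ?thesis"
    have slack: "0 < C $ i $ j - f $ i - g $ j" for i
    proof -
      have "(i, j) \<notin> tight C f g" using none by blast
      then show ?thesis using feas[of i j] by (simp add: tight_def)
    qed
    define d where "d = Min (range (\<lambda>i. C $ i $ j - f $ i - g $ j))"
    have "0 < d" using slack by (simp add: d_def)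
    have d: "d \<le> C $ i $ j - f $ i - g $ j" for i by (simp add: d_def)
    define g' where "g' = (\<chi> k. if k = j then g $ k + d else g $ k)"
    have "f $ i + g' $ k \<le> C $ i $ k" for i k
      using feas[of i k] d[of i] by (auto simp: g'_def)
    then have "g' = g" using maximal[of f g'] \<open>0 < d\<close> by (simp add: g'_def)
    then have "g' $ j = g $ j" by simp
    then show False using \<open>0 < d\<close> by (simp add: g'_def)
  qed
  ultimately show ?thesis by (simp add: no_isolated_vertex_def)
qed

text \<open>Going from \<open>i\<close> along a tight edge to \<open>j'\<close> and from \<open>j\<close> along a tight edge to \<open>i'\<close> expresses
  \<open>f\<^sub>i + g\<^sub>j\<close> as \<open>C\<^sub>i\<^sub>j\<^sub>' + C\<^sub>i\<^sub>'\<^sub>j - (f\<^sub>i\<^sub>' + g\<^sub>j\<^sub>')\<close>, and the last bracket is at most \<open>C\<^sub>i\<^sub>'\<^sub>j\<^sub>'\<close>. The frontier itself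
  is unbounded, but only along the shifts \<open>(f + s, g - s)\<close>, which these sums do not see.\<close>

lemma pareto_sum_ge:
  fixes C :: "real ^ 'n ^ 'm"
  assumes P: "(f, g) \<in> pareto_frontier C" and M: "\<And>i j. \<bar>C $ i $ j\<bar> \<le> M"
  shows "- (3 * M) \<le> f $ i + g $ j"
proof -
  obtain j' i' where "(i, j') \<in> tight C f g" "(i', j) \<in> tight C f g"
    using pareto_no_isolated_vertex[OF P] by (meson no_isolated_vertex_def)
  then have "f $ i + g $ j' = C $ i $ j'" "f $ i' + g $ j = C $ i' $ j" by (auto simp: tight_def)
  moreover have "f $ i' + g $ j' \<le> C $ i' $ j'"
    using P by (auto simp: pareto_frontier_def dual_polytope_def)
  ultimately show ?thesis using M[of i j'] M[of i' j] M[of i' j'] by linarith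
qed

section \<open>A single phase\<close>

lemma start_le_hitting_time: "ereal t \<le> hitting_time C E t f g v w"
  unfolding hitting_time_def by (rule Inf_greatest) auto

lemma constraint_before_hitting_time:
  assumes "t \<le> s" "ereal s < hitting_time C E t f g v w" "(i, j) \<notin> E"
  shows "f $ i + g $ j + (s - t) * (v $ i + w $ j) - C $ i $ j < 0"
proof (rule ccontr)
  let ?h = "\<lambda>(i, j). ereal (f $ i + g $ j + (s - t) * (v $ i + w $ j) - C $ i $ j)"
  assume "\<not> ?thesis"
  then have "0 \<le> ?h (i, j)" by simp
  also have "\<dots> \<le> (SUP x\<in>-E. ?h x)" using \<open>(i, j) \<notin> E\<close> by (intro SUP_upper) simp
  finally have "hitting_time C E t f g v w \<le> ereal s"
    unfolding hitting_time_def using \<open>t \<le> s\<close> by (intro Inf_lower) auto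
  then show False using assms(2) by simp
qed

text \<open>A constraint that is slack at the start of the phase and violated at its end would become tight
  strictly in between, at time \<open>t + \<alpha> / \<beta>\<close> where \<open>\<alpha>\<close> is the initial slack and \<open>\<beta>\<close> the speed at which it
  is used up; the phase would have ended then.\<close>

lemma constraint_at_hitting_time:
  assumes hit: "hitting_time C E t f g v w = ereal s" and ij: "(i, j) \<notin> E"
    and start: "f $ i + g $ j < C $ i $ j"
  shows "f $ i + g $ j + (s - t) * (v $ i + w $ j) \<le> C $ i $ j"
proof (rule ccontr)
  define \<alpha> where "\<alpha> = C $ i $ j - f $ i - g $ j"
  define \<beta> where "\<beta> = v $ i + w $ j"
  assume "\<not> ?thesis"
  then have late: "\<alpha> < (s - t) * \<beta>" by (simp add: \<alpha>_def \<beta>_def)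
  have "0 < \<alpha>" using start by (simp add: \<alpha>_def)
  have "t \<le> s" using start_le_hitting_time[of t C E f g v w] hit by simp
  moreover have "0 < (s - t) * \<beta>" using late \<open>0 < \<alpha>\<close> by linarith
  ultimately have "0 < \<beta>" by (auto simp: zero_less_mult_iff)
  then have "t \<le> t + \<alpha> / \<beta>" "t + \<alpha> / \<beta> < s"
    using late \<open>0 < \<alpha>\<close> by (simp, simp add: field_simps)
  then have "f $ i + g $ j + (t + \<alpha> / \<beta> - t) * \<beta> - C $ i $ j < 0"
    unfolding \<beta>_def using constraint_before_hitting_time[OF _ _ ij] hit by (metis less_ereal.simps(1))
  then show False using \<open>0 < \<beta>\<close> by (simp add: \<alpha>_def)
qed

text \<open>Without motion, a slack constraint is never reached, so a phase that ends has a nonzero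
  velocity.\<close>

lemma hitting_time_at_rest:
  fixes C :: "real ^ 'n ^ 'm"
  assumes "\<And>i j. (i, j) \<notin> E \<Longrightarrow> f $ i + g $ j < C $ i $ j"
  shows "hitting_time C E t f g 0 0 = \<infinity>"
proof -
  let ?h = "\<lambda>(i, j). ereal (f $ i + g $ j - C $ i $ j)"
  have "(SUP x\<in>-E. ?h x) < 0"
  proof (cases "-E = {}")
    case True
    then show ?thesis by (simp add: bot_ereal_def)
  next
    case False
    then have "(SUP x\<in>-E. ?h x) = Max (?h ` (-E))" by (intro cSup_eq_Max) auto
    also have "\<dots> < 0" using assms False by (subst Max_less_iff) auto
    finally show ?thesis .
  qed
  then have "{ereal s |s. t \<le> s \<and> 0 \<le> (SUP x\<in>-E. ?h x)} = {}" by (auto simp: not_le)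
  moreover have "hitting_time C E t f g 0 0 = Inf {ereal s |s. t \<le> s \<and> 0 \<le> (SUP x\<in>-E. ?h x)}"
    by (simp add: hitting_time_def)
  ultimately show ?thesis by (simp only: Inf_empty top_ereal_def)
qed

text \<open>That the phase ends is used twice: the hitting time controls the constraints outside \<open>E\<close>, and its
  finiteness excludes zero velocity, so that the lower bound \<open>c\<close> applies to the rate.\<close>

lemma phase_step:
  fixes \<mu> :: "real ^ 'm" and \<nu> :: "real ^ 'n" and C :: "real ^ 'n ^ 'm"
  assumes \<mu>\<nu>: "\<mu> \<in> prob_simplex" "\<And>i. 0 < \<mu> $ i" "\<nu> \<in> prob_simplex" "\<And>j. 0 < \<nu> $ j"
    and c: "\<And>E. no_isolated_vertex E \<Longrightarrow> v_star \<mu> \<nu> E \<noteq> 0 \<or> w_star \<mu> \<nu> E \<noteq> 0 \<Longrightarrow> c \<le> dual_rate \<mu> \<nu> E"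
    and E_def: "E = tight C f g" and E: "no_isolated_vertex E" and feas: "\<And>i j. f $ i + g $ j \<le> C $ i $ j"
    and v_def: "v = v_star \<mu> \<nu> E" and w_def: "w = w_star \<mu> \<nu> E"
    and hit: "hitting_time C E t f g v w = ereal s"
    and f': "f' = f + (s - t) *\<^sub>R v" and g': "g' = g + (s - t) *\<^sub>R w"
  shows "t \<le> s" and "no_isolated_vertex (tight C f' g')" and "f' $ i + g' $ j \<le> C $ i $ j"
    and "\<mu> \<bullet> f + \<nu> \<bullet> g + c * (s - t) \<le> \<mu> \<bullet> f' + \<nu> \<bullet> g'"
proof -
  show "t \<le> s" using start_le_hitting_time[of t C E f g v w] hit by simp
  have slack: "f $ i + g $ j < C $ i $ j" if "(i, j) \<notin> E" for i j
    using feas[of i j] that by (simp add: E_def tight_def less_le)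
  have sum': "f' $ i + g' $ j = f $ i + g $ j + (s - t) * (v $ i + w $ j)" for i j
    by (simp add: f' g' algebra_simps)
  show "f' $ i + g' $ j \<le> C $ i $ j"
  proof (cases "(i, j) \<in> E")
    case True
    then have "(s - t) * (v $ i + w $ j) \<le> 0"
      using velocity_structure(1)[OF \<mu>\<nu> E] \<open>t \<le> s\<close> by (simp add: v_def w_def mult_nonneg_nonpos)
    then show ?thesis using feas[of i j] by (simp add: sum')
  next
    case False
    then show ?thesis using constraint_at_hitting_time[OF hit False] slack by (simp add: sum')
  qed
  \<comment> \<open>Edges along which \<open>f + g\<close> is constant are still tight at the end.\<close>
  have "{(i, j) \<in> E. v $ i + w $ j = 0} \<subseteq> tight C f' g'"
    by (auto simp: E_def tight_def sum')
  then show "no_isolated_vertex (tight C f' g')"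
    using velocity_structure(2)[OF \<mu>\<nu> E] unfolding no_isolated_vertex_def v_def w_def by blast
  have "v \<noteq> 0 \<or> w \<noteq> 0"
    using hitting_time_at_rest[of E f g C t] slack hit by auto
  then have "c * (s - t) \<le> dual_rate \<mu> \<nu> E * (s - t)"
    using c[OF E] \<open>t \<le> s\<close> by (intro mult_right_mono) (auto simp: v_def w_def)
  then show "\<mu> \<bullet> f + \<nu> \<bullet> g + c * (s - t) \<le> \<mu> \<bullet> f' + \<nu> \<bullet> g'"
    by (simp add: f' g' inner_add_right dual_rate_def v_def w_def algebra_simps)
qed

lemma constant_velocity_motion:
  fixes f :: "real \<Rightarrow> 'a::banach"
  assumes "a \<le> b" "continuous_on {a..b} f"
    and deriv: "\<And>s. s \<in> {a..<b} \<Longrightarrow> (f has_vector_derivative v) (at s within {a..<b})"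
  shows "f b = f a + (b - a) *\<^sub>R v"
proof -
  let ?h = "\<lambda>s. f s - (s - a) *\<^sub>R v"
  have "?h b = f a"
  proof (rule has_derivative_zero_unique_strong_interval[where f = ?h and k = "{b}" and a = a and b = b])
    show "continuous_on {a..b} ?h" using assms(2) by (intro continuous_intros)
    fix s assume s: "s \<in> {a..b} - {b}"
    have "at s within {a..<b} = at s within {a..b}"
      using s by (intro at_within_nhd[of s "{..<b}"]) auto
    then have "(f has_vector_derivative v) (at s within {a..b})" using deriv[of s] s by auto
    then have "(?h has_vector_derivative v - 1 *\<^sub>R v) (at s within {a..b})"
      by (intro derivative_eq_intros | simp)+
    then show "(?h has_derivative (\<lambda>_. 0)) (at s within {a..b})"
      by (simp add: has_vector_derivative_def)
  qed (use \<open>a \<le> b\<close> in auto)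
  then show ?thesis by (simp add: algebra_simps)
qed

section \<open>The whole curve\<close>

text \<open>The last conjunct is the one that bounds the time; the others are needed to apply
  \<open>phase_step\<close> again.\<close>

lemma cold_sinkhorn_invariant:
  fixes \<mu> :: "real ^ 'm" and \<nu> :: "real ^ 'n" and C :: "real ^ 'n ^ 'm"
  assumes \<mu>\<nu>: "\<mu> \<in> prob_simplex" "\<And>i. 0 < \<mu> $ i" "\<nu> \<in> prob_simplex" "\<And>j. 0 < \<nu> $ j"
    and c: "\<And>E. no_isolated_vertex E \<Longrightarrow> v_star \<mu> \<nu> E \<noteq> 0 \<or> w_star \<mu> \<nu> E \<noteq> 0 \<Longrightarrow> c \<le> dual_rate \<mu> \<nu> E"
    and P: "(f0, g0) \<in> pareto_frontier C"
    and dyn: "cold_sinkhorn \<mu> \<nu> C f0 g0 L t v w E f g"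
  shows "l \<le> L \<Longrightarrow> 0 \<le> t l \<and> E l = tight C (f (t l)) (g (t l)) \<and> no_isolated_vertex (E l) \<and>
    (\<forall>i j. f (t l) $ i + g (t l) $ j \<le> C $ i $ j) \<and>
    \<mu> \<bullet> f0 + \<nu> \<bullet> g0 + c * t l \<le> \<mu> \<bullet> f (t l) + \<nu> \<bullet> g (t l)"
proof (induction l)
  case 0
  have "t 0 = 0" "f 0 = f0" "g 0 = g0" "E 0 = tight C f0 g0"
    using dyn by (auto simp: cold_sinkhorn_def tight_def)
  moreover have "\<forall>i j. f0 $ i + g0 $ j \<le> C $ i $ j"
    using P by (auto simp: pareto_frontier_def dual_polytope_def)
  ultimately show ?case using pareto_no_isolated_vertex[OF P] by simp
next
  case (Suc l)
  then have l: "l < L" and IH: "0 \<le> t l" "E l = tight C (f (t l)) (g (t l))" "no_isolated_vertex (E l)"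
    "\<And>i j. f (t l) $ i + g (t l) $ j \<le> C $ i $ j"
    "\<mu> \<bullet> f0 + \<nu> \<bullet> g0 + c * t l \<le> \<mu> \<bullet> f (t l) + \<nu> \<bullet> g (t l)"
    by auto
  have vw: "v l = v_star \<mu> \<nu> (E l)" "w l = w_star \<mu> \<nu> (E l)"
    and hit: "hitting_time C (E l) (t l) (f (t l)) (g (t l)) (v l) (w l) = ereal (t (Suc l))"
    and E_Suc: "E (Suc l) = {(i, j). f (t l) $ i + g (t l) $ j
                       + (t (Suc l) - t l) * (v l $ i + w l $ j) - C $ i $ j = 0}"
    using dyn l by (auto simp: cold_sinkhorn_def)
  have deriv: "(f has_vector_derivative v l) (at s within {t l..<t (Suc l)})"
    "(g has_vector_derivative w l) (at s within {t l..<t (Suc l)})" if "s \<in> {t l..<t (Suc l)}" for s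
    using dyn[unfolded cold_sinkhorn_def, THEN conjunct2, THEN conjunct2, THEN conjunct2,
        THEN conjunct2, THEN conjunct1, THEN spec[of _ l]] l that
    by simp_all
  have le: "t l \<le> t (Suc l)"
    using start_le_hitting_time[of "t l"] hit by (metis ereal_less_eq(3))
  have "continuous_on {t l..t (Suc l)} f" "continuous_on {t l..t (Suc l)} g"
    using dyn IH(1) unfolding cold_sinkhorn_def by (auto intro: continuous_on_subset)
  then have motion: "f (t (Suc l)) = f (t l) + (t (Suc l) - t l) *\<^sub>R v l"
    "g (t (Suc l)) = g (t l) + (t (Suc l) - t l) *\<^sub>R w l"
    using constant_velocity_motion[OF le] deriv by blast+
  note step = phase_step[OF \<mu>\<nu> c IH(2-4) vw hit motion]
  have "E (Suc l) = tight C (f (t (Suc l))) (g (t (Suc l)))"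
    unfolding E_Suc tight_def motion by (simp add: algebra_simps)
  moreover have "\<mu> \<bullet> f0 + \<nu> \<bullet> g0 + c * t (Suc l) \<le> \<mu> \<bullet> f (t (Suc l)) + \<nu> \<bullet> g (t (Suc l))"
    using step(4) IH(5) by (simp add: right_diff_distrib)
  ultimately show ?case using step(2,3) le IH(1) by auto
qed

theorem lemma3p6:
  fixes \<mu> :: "real ^ 'm" and \<nu> :: "real ^ 'n" and C :: "real ^ 'n ^ 'm"
  assumes "\<mu> \<in> prob_simplex" and "\<forall>i. 0 < \<mu> $ i"
    and "\<nu> \<in> prob_simplex" and "\<forall>j. 0 < \<nu> $ j"
  shows "\<exists>T::real. \<forall>f0 g0. (f0, g0) \<in> pareto_frontier C \<longrightarrow>
           (\<forall>L t v w E f g. cold_sinkhorn \<mu> \<nu> C f0 g0 L t v w E f g \<longrightarrow> t L \<le> T)"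
proof -
  have \<mu>\<nu>: "\<mu> \<in> prob_simplex" "\<And>i. 0 < \<mu> $ i" "\<nu> \<in> prob_simplex" "\<And>j. 0 < \<nu> $ j"
    using assms by auto
  obtain c where "0 < c" and c: "\<And>E. no_isolated_vertex E \<Longrightarrow>
    v_star \<mu> \<nu> E \<noteq> 0 \<or> w_star \<mu> \<nu> E \<noteq> 0 \<Longrightarrow> c \<le> dual_rate \<mu> \<nu> E"
    using dual_rate_bounded_below[OF \<mu>\<nu>] by blast
  define M where "M = Max (range (\<lambda>(i, j). \<bar>C $ i $ j\<bar>))"
  have M: "\<bar>C $ i $ j\<bar> \<le> M" for i j
    unfolding M_def by (rule Max_ge) (auto intro: rev_image_eqI[of "(i, j)"])
  \<comment> \<open>On the feasible set the dual objective is at most \<open>M\<close>, and it starts from at least \<open>- 3 M\<close>.\<close>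
  have "t L \<le> 4 * M / c"
    if P: "(f0, g0) \<in> pareto_frontier C" and dyn: "cold_sinkhorn \<mu> \<nu> C f0 g0 L t v w E f g"
    for f0 g0 L t v w E f g
  proof -
    have final: "\<And>i j. f (t L) $ i + g (t L) $ j \<le> C $ i $ j"
      "\<mu> \<bullet> f0 + \<nu> \<bullet> g0 + c * t L \<le> \<mu> \<bullet> f (t L) + \<nu> \<bullet> g (t L)"
      using cold_sinkhorn_invariant[OF \<mu>\<nu> c P dyn order_refl] by auto
    have "f (t L) $ i + g (t L) $ j \<le> M" for i j using final(1)[of i j] M[of i j] by linarith
    then have "\<mu> \<bullet> f (t L) + \<nu> \<bullet> g (t L) \<le> M" by (rule dual_value_le[OF \<mu>\<nu>(1,3)])
    moreover have "(- f0) $ i + (- g0) $ j \<le> 3 * M" for i j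
      using pareto_sum_ge[OF P M, of i j] by simp
    then have "\<mu> \<bullet> (- f0) + \<nu> \<bullet> (- g0) \<le> 3 * M" by (rule dual_value_le[OF \<mu>\<nu>(1,3)])
    ultimately have "c * t L \<le> 4 * M" using final(2) by simp
    then show ?thesis using \<open>0 < c\<close> by (simp add: pos_le_divide_eq mult.commute)
  qed
  then show ?thesis by blast
qed

end
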